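(* For $i=1,\dots,m$ let $\Lambda_i\cong\mathbb{Z}^{d_i}$ be a lattice in $\mathbb{R}^{d_i}$, let $C_i\subset\mathbb{R}^{d_i}$ be a convex body containing the origin, and let $k_i>0$. Let \[C:=\bigoplus_i k_iC_i=k_1C_1\oplus\dots\oplus k_mC_m\subset\mathbb{R}^{d_1+\dots+d_m},\] considered with respect to the lattice $\Lambda=\Lambda_1\oplus\dots\oplus\Lambda_m$. Then: (1) If $k_iC_i$ is a lattice polytope for every $i$, then $C$ is a lattice polytope. (2) If $C_i$ is a simplex with a vertex at the origin for every $i$, then $C$ is a simplex with a vertex at the origin. (3) The lattice width of $C$ equals $\min_i\{k_i\operatorname{width}(C_i)\}$. (4) If $C_i$ is hollow for every $i$ and $\sum_i \frac1{k_i}\ge1$, then $C$ is hollow.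
   Context: The direct sum of convex bodies $C_i\subset\mathbb{R}^{d_i}$ containing the origin is $C_1\oplus\dots\oplus C_m=\{(\lambda_1x_1,\dots,\lambda_mx_m): x_i\in C_i,\ \lambda_i\ge0,\ \sum_i\lambda_i=1\}$. $kC$ denotes dilation by factor $k$. A convex body is hollow with respect to a lattice if its interior contains no lattice point. The (lattice) width of $K$ with respect to a lattice $\Lambda$ is $\inf_{f\in\Lambda^*\setminus\{0\}}$ of the length of the segment $f(K)$, $\Lambda^*$ being the dual lattice; $\operatorname{width}(C_i)$ is taken with respect to $\Lambda_i$. A lattice polytope is a polytope with vertices in the lattice. *)

theory Defs
  imports "HOL-Analysis.Analysis"
begin

text \<open>
  The dimensions \<open>d i\<close> vary with \<open>i\<close>, so the space of dimension \<open>d i\<close> is a subspace \<open>V i\<close>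
  of dimension \<open>d i\<close> of an arbitrary Euclidean type \<open>'a\<close>; coordinate subspaces give
  the standard spaces, and every sequence of dimensions occurs for a suitable \<open>'a\<close>.
  The space of dimension \<open>d\<^sub>1 + \<dots> + d\<^sub>m\<close> consists of the tuples
  \<open>x :: 'a ^ 'm\<close> with \<open>x $ i \<in> V i\<close>, where \<open>m = CARD('m)\<close>. Interiors are taken relative to
  these spaces.
\<close>

definition direct_product :: "('m::finite \<Rightarrow> 'a set) \<Rightarrow> ('a ^ 'm) set"
  where "direct_product A = {x. \<forall>i. x $ i \<in> A i}"

definition lattice_in :: "'a::euclidean_space set \<Rightarrow> 'a set \<Rightarrow> bool"
  where "lattice_in V \<Lambda> \<longleftrightarrow>
    (\<exists>B. independent B \<and> span B = V \<and>
         \<Lambda> = {(\<Sum>b\<in>B. of_int (z b) *\<^sub>R b) | z :: 'a \<Rightarrow> int. True})"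

definition convex_body :: "'a::euclidean_space set \<Rightarrow> 'a set \<Rightarrow> bool"
  where "convex_body V C \<longleftrightarrow>
    C \<subseteq> V \<and> convex C \<and> compact C \<and> top_of_set V interior_of C \<noteq> {}"

definition direct_sum :: "('m::finite \<Rightarrow> 'a::euclidean_space set) \<Rightarrow> ('a ^ 'm) set"
  where "direct_sum C =
    {(\<chi> i. l i *\<^sub>R x i) | l x. (\<forall>i. x i \<in> C i) \<and> (\<forall>i. 0 \<le> l i) \<and> (\<Sum>i\<in>UNIV. l i) = 1}"

definition hollow :: "'a::euclidean_space set \<Rightarrow> 'a set \<Rightarrow> 'a set \<Rightarrow> bool"
  where "hollow V \<Lambda> C \<longleftrightarrow> (top_of_set V interior_of C) \<inter> \<Lambda> = {}"

definition lattice_polytope :: "'a::euclidean_space set \<Rightarrow> 'a set \<Rightarrow> bool"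
  where "lattice_polytope \<Lambda> P \<longleftrightarrow> polytope P \<and> (\<forall>v. v extreme_point_of P \<longrightarrow> v \<in> \<Lambda>)"

definition simplex_with_origin :: "'a::euclidean_space set \<Rightarrow> bool"
  where "simplex_with_origin C \<longleftrightarrow> (\<exists>n. n simplex C) \<and> 0 extreme_point_of C"

text \<open>
  Linear functionals on the space spanned by the lattice are identified with vectors of
  that space by the inner product.
\<close>

definition dual_lattice :: "'a::euclidean_space set \<Rightarrow> 'a set"
  where "dual_lattice \<Lambda> = {f \<in> span \<Lambda>. \<forall>x\<in>\<Lambda>. f \<bullet> x \<in> \<int>}"

text \<open>
  The values are extended reals only because the infimum is over the empty set (hence
  infinite) in dimension zero.
\<close>

definition lattice_width :: "'a::euclidean_space set \<Rightarrow> 'a set \<Rightarrow> ereal"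
  where "lattice_width \<Lambda> K =
    (INF f\<in>dual_lattice \<Lambda> - {0}. ereal ((SUP x\<in>K. f \<bullet> x) - (INF x\<in>K. f \<bullet> x)))"

end

theory Submission
  imports Defs
begin

text \<open>
  The direct sum is the convex hull of the summands placed on the coordinate axes, so its
  vertices are vertices of the summands, and linearly independent nonzero vertices of
  simplices at the origin stay independent. For the width, a functional \<open>f = (f\<^sub>1, \<dots>, f\<^sub>m)\<close>
  with \<open>f\<^sub>i \<noteq> 0\<close> has length at least \<open>k\<^sub>i\<close> times the length of \<open>f\<^sub>i(C\<^sub>i)\<close>, with equality
  when the other components vanish.

  If a lattice point \<open>x\<close> lies in the interior of \<open>D\<close>, then \<open>x = (l\<^sub>1 k\<^sub>1 c\<^sub>1, \<dots>, l\<^sub>m k\<^sub>m c\<^sub>m)\<close>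
  with \<open>c\<^sub>i \<in> C\<^sub>i\<close> and \<open>\<Sum> l\<^sub>i < 1 \<le> \<Sum> 1 / k\<^sub>i\<close>, so \<open>l\<^sub>i k\<^sub>i < 1\<close> for some \<open>i\<close>.
  As \<open>x\<^sub>i\<close> is interior to \<open>k\<^sub>i C\<^sub>i\<close> and in a dilate of \<open>C\<^sub>i\<close> by a factor below 1, it is
  a lattice point interior to \<open>C\<^sub>i\<close>.
\<close>

section \<open>Axis embeddings and the direct sum as a convex hull\<close>

lemma linear_axis: "linear (axis i :: 'a::real_vector \<Rightarrow> 'a ^ 'm::finite)"
  by (rule linearI) (simp_all add: vec_eq_iff axis_def)

lemma sum_axis: "(\<Sum>i\<in>UNIV. axis i (x i)) = (\<chi> i. x i)"
  for x :: "'m::finite \<Rightarrow> 'a::comm_monoid_add"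
  by (simp add: vec_eq_iff axis_def)

text \<open>The hull of a finite union of nonempty convex sets needs only one point from each set.
  Linearity of \<open>axis i\<close> moves the weight \<open>l i\<close> into coordinate
  \<open>i\<close>, and the sum over the axes reassembles the tuple.\<close>

lemma direct_sum_eq_convex_hull:
  fixes K :: "'m::finite \<Rightarrow> 'a::euclidean_space set"
  assumes "\<And>i. convex (K i)" "\<And>i. K i \<noteq> {}"
  shows "direct_sum K = convex hull (\<Union>i. axis i ` K i)"
proof -
  have "convex hull (\<Union>i. axis i ` K i) =
      {(\<Sum>i\<in>UNIV. l i *\<^sub>R y i) | l y.
        (\<forall>i\<in>UNIV. 0 \<le> l i) \<and> sum l UNIV = 1 \<and> (\<forall>i\<in>UNIV. y i \<in> axis i ` K i)}"
    by (rule convex_hull_finite_union) (use assms in \<open>auto intro: convex_linear_image linear_axis\<close>)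
  also have "\<dots> = direct_sum K"
  proof (intro set_eqI iffI)
    fix z assume "z \<in> {(\<Sum>i\<in>UNIV. l i *\<^sub>R y i) | l y.
        (\<forall>i\<in>UNIV. 0 \<le> l i) \<and> sum l UNIV = 1 \<and> (\<forall>i\<in>UNIV. y i \<in> axis i ` K i)}"
    then obtain l y where l: "\<And>i. 0 \<le> l i" "sum l UNIV = 1"
      and y: "\<And>i. y i \<in> axis i ` K i" and z: "z = (\<Sum>i\<in>UNIV. l i *\<^sub>R y i)"
      by blast
    from y have "\<exists>x. \<forall>i. x i \<in> K i \<and> y i = axis i (x i)"
      by (intro choice) blast
    then obtain x where x: "\<And>i. x i \<in> K i" "\<And>i. y i = axis i (x i)"
      by blast
    have "z = (\<chi> i. l i *\<^sub>R x i)"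
      unfolding z x(2) linear_scale[OF linear_axis, symmetric] by (rule sum_axis)
    then show "z \<in> direct_sum K"
      using l x(1) unfolding direct_sum_def by blast
  next
    fix z assume "z \<in> direct_sum K"
    then obtain l x where l: "\<And>i. 0 \<le> l i" "sum l UNIV = 1"
      and x: "\<And>i. x i \<in> K i" and z: "z = (\<chi> i. l i *\<^sub>R x i)"
      unfolding direct_sum_def by blast
    have "z = (\<Sum>i\<in>UNIV. l i *\<^sub>R axis i (x i))"
      unfolding z linear_scale[OF linear_axis, symmetric] by (rule sum_axis[symmetric])
    then show "z \<in> {(\<Sum>i\<in>UNIV. l i *\<^sub>R y i) | l y.
        (\<forall>i\<in>UNIV. 0 \<le> l i) \<and> sum l UNIV = 1 \<and> (\<forall>i\<in>UNIV. y i \<in> axis i ` K i)}"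
      using l x by (intro CollectI exI[of _ l] exI[of _ "\<lambda>i. axis i (x i)"]) auto
  qed
  finally show ?thesis by simp
qed

text \<open>Generators of the summands, placed on the axes, generate the direct sum. This supplies
  the finite generating sets for both polytopes and simplices.\<close>

lemma direct_sum_convex_hull:
  fixes S :: "'m::finite \<Rightarrow> 'a::euclidean_space set"
  assumes "\<And>i. S i \<noteq> {}"
  shows "direct_sum (\<lambda>i. convex hull S i) = convex hull (\<Union>i. axis i ` S i)"
proof -
  have "direct_sum (\<lambda>i. convex hull S i) = convex hull (\<Union>i. convex hull (axis i ` S i))"
    using assms
    by (simp add: direct_sum_eq_convex_hull convex_hull_linear_image[OF linear_axis])
  also have "\<dots> = convex hull (\<Union>i. axis i ` S i)"
  proof (rule hull_unique)
    show "(\<Union>i. convex hull (axis i ` S i)) \<subseteq> convex hull (\<Union>i. axis i ` S i)"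
      by (intro UN_least hull_mono) blast
  next
    fix T :: "('a ^ 'm) set"
    assume T: "(\<Union>i. convex hull (axis i ` S i)) \<subseteq> T" "convex T"
    have "(\<Union>i. axis i ` S i) \<subseteq> (\<Union>i. convex hull (axis i ` S i))"
      by (intro UN_mono hull_subset subset_refl)
    then show "convex hull (\<Union>i. axis i ` S i) \<subseteq> T"
      using T by (intro hull_minimal) auto
  qed (rule convex_convex_hull)
  finally show ?thesis .
qed

text \<open>All the weight goes to coordinate \<open>i\<close>; the other summands contribute their
  origin with weight 0.\<close>

lemma axis_mem_direct_sum:
  assumes "\<And>i. 0 \<in> K i" "x \<in> K i"
  shows "axis i x \<in> direct_sum K"
proof -
  have "axis i x = (\<chi> j. (if j = i then 1 else 0) *\<^sub>R (if j = i then x else 0))"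
    by (auto simp: vec_eq_iff axis_def)
  moreover have "\<forall>j. (if j = i then x else 0) \<in> K j"
    using assms by simp
  ultimately show ?thesis
    unfolding direct_sum_def
    by (intro CollectI exI[of _ "\<lambda>j. if j = i then 1 else 0"] exI[of _ "\<lambda>j. if j = i then x else 0"])
      auto
qed

text \<open>Projecting a dependence to the coordinate \<open>i\<close> of the dependent vector kills
  the vectors on all other axes and leaves a dependence inside \<open>B i\<close>.\<close>

lemma independent_Union_axis:
  fixes B :: "'m::finite \<Rightarrow> 'a::euclidean_space set"
  assumes "\<And>i. independent (B i)"
  shows "independent (\<Union>i. axis i ` B i)"
proof
  let ?U = "\<Union>i. axis i ` B i"
  assume "dependent ?U"
  then obtain a where "a \<in> ?U" and a: "a \<in> span (?U - {a})"
    unfolding dependent_def by blast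
  then obtain i b where b: "b \<in> B i" "a = axis i b" by blast
  have lin: "linear (\<lambda>x :: 'a ^ 'm. x $ i)"
    by (rule linearI) simp_all
  have "b = a $ i" using b by (simp add: axis_def)
  also have "\<dots> \<in> (\<lambda>x. x $ i) ` span (?U - {a})" using a by blast
  also have "\<dots> = span ((\<lambda>x. x $ i) ` (?U - {a}))"
    by (rule linear_span_image[OF lin, symmetric])
  \<comment> \<open>The \<open>0\<close> absorbs the vectors from the other axes; a vector on axis
    \<open>i\<close> itself differs from \<open>a\<close>, so its projection differs from
    \<open>b\<close>.\<close>
  also have "\<dots> \<subseteq> span (insert 0 (B i - {b}))"
  proof (intro span_mono image_subsetI)
    fix z assume z: "z \<in> ?U - {a}"
    then obtain j c where c: "c \<in> B j" "z = axis j c" by blast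
    show "z $ i \<in> insert 0 (B i - {b})"
      using z b c by (cases "j = i") (auto simp: axis_def)
  qed
  finally have "b \<in> span (B i - {b})" by (simp add: span_insert_0)
  then show False
    using assms[of i] b unfolding dependent_def by blast
qed

section \<open>Lattice polytopes\<close>

text \<open>Extreme points of a hull lie among its generators. Each generator here is a vertex of
  one \<open>P i\<close> on its axis, and its remaining coordinates are 0, hence lattice
  points.\<close>

lemma lattice_polytope_direct_sum:
  fixes P \<Lambda> :: "'m::finite \<Rightarrow> 'a::euclidean_space set"
  assumes P: "\<And>i. lattice_polytope (\<Lambda> i) (P i)" and "\<And>i. P i \<noteq> {}" "\<And>i. 0 \<in> \<Lambda> i"
  shows "lattice_polytope (direct_product \<Lambda>) (direct_sum P)"
proof -
  define E where "E i = {v. v extreme_point_of P i}" for i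
  have poly: "polytope (P i)" for i
    using P unfolding lattice_polytope_def by blast
  have finE: "finite (E i)" for i
    unfolding E_def by (rule finite_polyhedron_extreme_points[OF polytope_imp_polyhedron[OF poly]])
  have hullE: "P i = convex hull E i" for i
    unfolding E_def
    by (rule Krein_Milman_Minkowski[OF polytope_imp_compact[OF poly] polytope_imp_convex[OF poly]])
  have neE: "E i \<noteq> {}" for i
    using hullE[of i] assms(2)[of i] by auto
  have "P = (\<lambda>i. convex hull E i)"
    using hullE by (rule ext)
  then have "direct_sum P = direct_sum (\<lambda>i. convex hull E i)"
    by (rule arg_cong)
  also have "\<dots> = convex hull (\<Union>i. axis i ` E i)"
    by (rule direct_sum_convex_hull[OF neE])
  finally have D: "direct_sum P = convex hull (\<Union>i. axis i ` E i)" .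
  have "polytope (direct_sum P)"
    unfolding D polytope_def using finE by (intro exI conjI) auto
  moreover have "v \<in> direct_product \<Lambda>" if v: "v extreme_point_of direct_sum P" for v
  proof -
    obtain i w where w: "w \<in> E i" "v = axis i w"
      using extreme_point_of_convex_hull v unfolding D by blast
    then have "w \<in> \<Lambda> i"
      using P unfolding E_def lattice_polytope_def by blast
    then show ?thesis
      using w assms(3) by (simp add: direct_product_def axis_def)
  qed
  ultimately show ?thesis
    unfolding lattice_polytope_def by blast
qed

section \<open>Simplices with a vertex at the origin\<close>

text \<open>Affine independence of a set containing 0 is linear independence of its other points.
  This turns the claim about simplices into linear algebra.\<close>

lemma simplex_with_origin_iff:
  "simplex_with_origin C \<longleftrightarrow> (\<exists>B. independent B \<and> C = convex hull (insert 0 B))"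
proof
  assume "simplex_with_origin C"
  then obtain S where S: "\<not> affine_dependent S" "C = convex hull S" "0 extreme_point_of C"
    unfolding simplex_with_origin_def simplex by blast
  then have "0 \<in> S" using extreme_point_of_convex_hull by blast
  then show "\<exists>B. independent B \<and> C = convex hull (insert 0 B)"
    using S affine_dependent_iff_dependent2[of 0 S]
    by (intro exI[of _ "S - {0}"]) (auto simp: insert_absorb)
next
  assume "\<exists>B. independent B \<and> C = convex hull (insert 0 B)"
  then obtain B where B: "independent B" "C = convex hull (insert 0 B)" by blast
  then have "0 \<notin> B" using dependent_zero by blast
  then have aff: "\<not> affine_dependent (insert 0 B)"
    using B affine_dependent_iff_dependent[of 0 B] by simp
  \<comment> \<open>The dimension is one less than the number of vertices; for empty
    \<open>B\<close> this is the 0-simplex consisting of the origin.\<close>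
  have "(int (card (insert 0 B)) - 1) simplex C"
    unfolding simplex using aff aff_independent_finite[OF aff] B(2)
    by (intro exI[of _ "insert 0 B"]) auto
  then show "simplex_with_origin C"
    unfolding simplex_with_origin_def
    using extreme_point_of_convex_hull_affine_independent[OF aff] B(2) by blast
qed

lemma simplex_with_origin_scaleR:
  assumes "simplex_with_origin C" "k \<noteq> 0"
  shows "simplex_with_origin ((*\<^sub>R) k ` C)"
proof -
  obtain B where B: "independent B" "C = convex hull (insert 0 B)"
    using assms(1) unfolding simplex_with_origin_iff by blast
  have "independent ((*\<^sub>R) k ` B)"
    by (rule linear_independent_injective_image[OF _ B(1)])
      (use assms(2) in \<open>auto simp: linear_scaleR intro: inj_onI\<close>)
  moreover have "(*\<^sub>R) k ` C = convex hull (insert 0 ((*\<^sub>R) k ` B))"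
    unfolding B(2) by (simp add: convex_hull_scaling[symmetric])
  ultimately show ?thesis
    unfolding simplex_with_origin_iff by blast
qed

text \<open>The origins of all summands become one common vertex, and the other vertices stay
  linearly independent on their axes.\<close>

lemma simplex_with_origin_direct_sum:
  fixes K :: "'m::finite \<Rightarrow> 'a::euclidean_space set"
  assumes "\<And>i. simplex_with_origin (K i)"
  shows "simplex_with_origin (direct_sum K)"
proof -
  have "\<exists>B. \<forall>i. independent (B i) \<and> K i = convex hull (insert 0 (B i))"
    by (intro choice) (use assms simplex_with_origin_iff in blast)
  then obtain B where B: "\<And>i. independent (B i)" "\<And>i. K i = convex hull (insert 0 (B i))"
    by blast
  have "K = (\<lambda>i. convex hull (insert 0 (B i)))"
    using B(2) by (rule ext)
  then have "direct_sum K = direct_sum (\<lambda>i. convex hull (insert 0 (B i)))"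
    by (rule arg_cong)
  also have "\<dots> = convex hull (\<Union>i. axis i ` insert 0 (B i))"
    by (rule direct_sum_convex_hull) (rule insert_not_empty)
  also have "(\<Union>i. axis i ` insert 0 (B i)) = insert 0 (\<Union>i. axis i ` B i)"
    by (auto simp: linear_0[OF linear_axis])
  finally have "direct_sum K = convex hull (insert 0 (\<Union>i. axis i ` B i))" .
  with independent_Union_axis[OF B(1)] show ?thesis
    unfolding simplex_with_origin_iff by (intro exI conjI)
qed

section \<open>Dual lattices and lattice width\<close>

lemma compact_direct_sum:
  fixes K :: "'m::finite \<Rightarrow> 'a::euclidean_space set"
  assumes "\<And>i. convex (K i)" "\<And>i. K i \<noteq> {}" "\<And>i. compact (K i)"
  shows "compact (direct_sum K)"
  unfolding direct_sum_eq_convex_hull[OF assms(1,2)]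
  by (intro compact_convex_hull compact_UN compact_continuous_image linear_continuous_on
      linear_conv_bounded_linear[THEN iffD1] linear_axis assms finite)

lemma bdd_inner_image:
  fixes K :: "'a::euclidean_space set"
  assumes "compact K"
  shows "bdd_above ((\<lambda>x. f \<bullet> x) ` K)" "bdd_below ((\<lambda>x. f \<bullet> x) ` K)"
proof -
  have "bounded ((\<lambda>x. f \<bullet> x) ` K)"
    by (intro compact_imp_bounded compact_continuous_image assms continuous_intros)
  then show "bdd_above ((\<lambda>x. f \<bullet> x) ` K)" "bdd_below ((\<lambda>x. f \<bullet> x) ` K)"
    by (simp_all add: bounded_imp_bdd_above bounded_imp_bdd_below)
qed

text \<open>Each tuple is the sum of its axis components, and \<open>axis i\<close> maps
  \<open>\<Lambda> i\<close> into the product because all other coordinates may be 0.\<close>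

lemma span_direct_product:
  assumes "\<And>i. subspace (V i)" "\<And>i. span (\<Lambda> i) = V i" "\<And>i. 0 \<in> \<Lambda> i"
  shows "span (direct_product \<Lambda>) = direct_product V"
proof
  have "subspace (direct_product V)"
    using assms(1) unfolding subspace_def direct_product_def by simp
  moreover have "direct_product \<Lambda> \<subseteq> direct_product V"
    using assms(2) span_base unfolding direct_product_def by blast
  ultimately show "span (direct_product \<Lambda>) \<subseteq> direct_product V"
    by (rule span_minimal[rotated])
next
  show "direct_product V \<subseteq> span (direct_product \<Lambda>)"
  proof
    fix x assume x: "x \<in> direct_product V"
    have "axis i (x $ i) \<in> span (direct_product \<Lambda>)" for i
    proof -
      have "axis i (x $ i) \<in> axis i ` span (\<Lambda> i)"
        using x assms(2) unfolding direct_product_def by blast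
      also have "\<dots> = span (axis i ` \<Lambda> i)"
        by (rule linear_span_image[OF linear_axis, symmetric])
      also have "\<dots> \<subseteq> span (direct_product \<Lambda>)"
        using assms(3) by (intro span_mono) (auto simp: direct_product_def axis_def)
      finally show ?thesis .
    qed
    then have "(\<Sum>i\<in>UNIV. axis i (x $ i)) \<in> span (direct_product \<Lambda>)"
      by (intro span_sum)
    then show "x \<in> span (direct_product \<Lambda>)"
      by (simp add: sum_axis)
  qed
qed

text \<open>Pairing \<open>f\<close> with lattice vectors on a single axis isolates the component
  \<open>f $ i\<close>. Conversely, the pairing with any tuple is a finite sum of integers.\<close>

lemma dual_lattice_direct_product:
  assumes "\<And>i. 0 \<in> \<Lambda> i"
  shows "dual_lattice (direct_product \<Lambda>) = direct_product (\<lambda>i. dual_lattice (\<Lambda> i))"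
proof (intro set_eqI iffI)
  have span: "span (direct_product \<Lambda>) = direct_product (\<lambda>i. span (\<Lambda> i))"
    by (rule span_direct_product) (use assms in auto)
  fix f
  {
    assume f: "f \<in> dual_lattice (direct_product \<Lambda>)"
    have "f $ i \<bullet> x \<in> \<int>" if "x \<in> \<Lambda> i" for i x
    proof -
      have "axis i x \<in> direct_product \<Lambda>"
        using that assms by (simp add: direct_product_def axis_def)
      then have "f \<bullet> axis i x \<in> \<int>"
        using f unfolding dual_lattice_def by blast
      then show ?thesis by (simp add: inner_axis)
    qed
    then show "f \<in> direct_product (\<lambda>i. dual_lattice (\<Lambda> i))"
      using f unfolding dual_lattice_def span by (simp add: direct_product_def)
  next
    assume "f \<in> direct_product (\<lambda>i. dual_lattice (\<Lambda> i))"
    then show "f \<in> dual_lattice (direct_product \<Lambda>)"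
      unfolding dual_lattice_def span
      by (auto simp: direct_product_def inner_vec_def intro: Ints_sum)
  }
qed

text \<open>Empty \<open>A\<close> is included, with both sides infinite; this occurs for summands
  of dimension zero.\<close>

lemma INF_ereal_cmult:
  assumes "0 < c"
  shows "(INF x\<in>A. ereal c * f x) = ereal c * (INF x\<in>A. f x)"
proof -
  have "{ereal c * y |y. y \<in> f ` A} = (\<lambda>x. ereal c * f x) ` A" by blast
  then show ?thesis
    using ereal_Inf_cmult[OF assms, of "\<lambda>y. y \<in> f ` A"] by simp
qed

text \<open>Multiplication by a positive constant is continuous and increasing, so it commutes with
  real suprema and infima of nonempty bounded sets.\<close>

lemma SUP_INF_cmult:
  fixes h :: "'b \<Rightarrow> real"
  assumes "0 < c" "A \<noteq> {}" "bdd_above (h ` A)" "bdd_below (h ` A)"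
  shows "(SUP x\<in>A. c * h x) - (INF x\<in>A. c * h x) = c * ((SUP x\<in>A. h x) - (INF x\<in>A. h x))"
proof -
  have mono: "mono ((*) c)"
    using assms(1) by (simp add: mono_def)
  have "c * Sup (h ` A) = (SUP y\<in>h ` A. c * y)"
    by (rule continuous_at_Sup_mono[OF mono]) (use assms in \<open>auto intro!: continuous_intros\<close>)
  moreover have "c * Inf (h ` A) = (INF y\<in>h ` A. c * y)"
    by (rule continuous_at_Inf_mono[OF mono]) (use assms in \<open>auto intro!: continuous_intros\<close>)
  ultimately show ?thesis
    by (simp add: image_image right_diff_distrib)
qed

text \<open>The quantity minimized in \<open>lattice_width\<close>, kept real so that it can be
  estimated before the cast to \<open>ereal\<close>.\<close>

definition length_of_image :: "'a::euclidean_space \<Rightarrow> 'a set \<Rightarrow> real"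
  where "length_of_image f K = (SUP x\<in>K. f \<bullet> x) - (INF x\<in>K. f \<bullet> x)"

lemma lattice_width_scaled_direct_sum:
  fixes C \<Lambda> :: "'m::finite \<Rightarrow> 'a::euclidean_space set"
  assumes convex: "\<And>i. convex (C i)" and compact: "\<And>i. compact (C i)" and zero: "\<And>i. 0 \<in> C i"
    and \<Lambda>: "\<And>i. 0 \<in> \<Lambda> i" and k: "\<And>i. 0 < k i"
  defines "D \<equiv> direct_sum (\<lambda>i. (*\<^sub>R) (k i) ` C i)"
  shows "lattice_width (direct_product \<Lambda>) D = (MIN i. ereal (k i) * lattice_width (\<Lambda> i) (C i))"
proof (rule antisym)
  define W where "W i = ereal (k i) * lattice_width (\<Lambda> i) (C i)" for i
  have zerok: "0 \<in> (*\<^sub>R) (k i) ` C i" for i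
    using zero[of i] by (auto intro: image_eqI[of _ _ 0])
  have "compact D"
    unfolding D_def
    by (intro compact_direct_sum convex_scaling convex compact_scaling compact) (use zerok in auto)
  note bdd = bdd_inner_image[OF this]
  have ne: "C i \<noteq> {}" for i
    using zero by blast
  have w_scale: "(SUP x\<in>C i. k i * (g \<bullet> x)) - (INF x\<in>C i. k i * (g \<bullet> x)) = k i * length_of_image g (C i)"
    for g i
    unfolding length_of_image_def by (intro SUP_INF_cmult bdd_inner_image compact k ne)
  have W: "W i = (INF g\<in>dual_lattice (\<Lambda> i) - {0}. ereal (k i * length_of_image g (C i)))" for i
    unfolding W_def lattice_width_def length_of_image_def 
    using INF_ereal_cmult[OF k, of i "\<lambda>g. ereal (length_of_image g (C i))" "dual_lattice (\<Lambda> i) - {0}"]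
    by (simp add: length_of_image_def)
  \<comment> \<open>Points of the \<open>i\<close>-th summand on its axis belong to \<open>D\<close>
    and see only the component \<open>f $ i\<close>. A larger set of values has larger supremum and
    smaller infimum, which gives \<open>w_le\<close>.\<close>
  have sub: "(\<lambda>x. k i * (f $ i \<bullet> x)) ` C i \<subseteq> (\<lambda>x. f \<bullet> x) ` D" for f i
  proof
    fix r assume "r \<in> (\<lambda>x. k i * (f $ i \<bullet> x)) ` C i"
    then obtain x where x: "x \<in> C i" "r = k i * (f $ i \<bullet> x)" by blast
    then have "axis i (k i *\<^sub>R x) \<in> D"
      unfolding D_def by (intro axis_mem_direct_sum zerok imageI)
    then show "r \<in> (\<lambda>x. f \<bullet> x) ` D"
      using x by (intro image_eqI[of _ _ "axis i (k i *\<^sub>R x)"]) (auto simp: inner_axis)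
  qed
  have w_le: "k i * length_of_image (f $ i) (C i) \<le> length_of_image f D" for f i
    unfolding w_scale[symmetric] unfolding length_of_image_def
    by (intro diff_mono cSup_subset_mono cInf_superset_mono sub bdd) (simp_all add: ne)
  have w_axis: "length_of_image (axis i g) D = k i * length_of_image g (C i)" for i g
  proof -
    have "(\<lambda>x. axis i g \<bullet> x) ` D = (\<lambda>x. k i * (g \<bullet> x)) ` C i"
    proof
      show "(\<lambda>x. k i * (g \<bullet> x)) ` C i \<subseteq> (\<lambda>x. axis i g \<bullet> x) ` D"
        using sub[of i "axis i g"] by (simp add: axis_def)
    next
      show "(\<lambda>x. axis i g \<bullet> x) ` D \<subseteq> (\<lambda>x. k i * (g \<bullet> x)) ` C i"
      proof (intro image_subsetI)
        fix z assume "z \<in> D"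
        then obtain l x where l: "\<And>i. 0 \<le> l i" "sum l UNIV = 1"
          and x: "\<And>i. x i \<in> (*\<^sub>R) (k i) ` C i" and z: "z = (\<chi> i. l i *\<^sub>R x i)"
          unfolding D_def direct_sum_def by blast
        obtain c where c: "c \<in> C i" "x i = k i *\<^sub>R c" using x by blast
        \<comment> \<open>A weight at most 1 pulls \<open>c\<close> towards the origin, which lies
          in \<open>C i\<close>; so an axis functional takes no values on \<open>D\<close> beyond
          those on the summand.\<close>
        have "l i \<le> 1"
          using member_le_sum[of i UNIV l] l by simp
        then have "l i *\<^sub>R c \<in> C i"
          using convexD[OF convex[of i] c(1) zero[of i], of "l i" "1 - l i"] l(1) by simp
        moreover have "axis i g \<bullet> z = k i * (g \<bullet> (l i *\<^sub>R c))"
          by (simp add: z inner_axis' c(2))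
        ultimately show "axis i g \<bullet> z \<in> (\<lambda>x. k i * (g \<bullet> x)) ` C i" by blast
      qed
    qed
    then show ?thesis
      using w_scale[of i g] by (simp add: length_of_image_def)
  qed
  have dual: "dual_lattice (direct_product \<Lambda>) = direct_product (\<lambda>i. dual_lattice (\<Lambda> i))"
    by (rule dual_lattice_direct_product[OF \<Lambda>])
  have dual0: "0 \<in> dual_lattice (\<Lambda> i)" for i
    by (simp add: dual_lattice_def span_zero)
  have wD: "lattice_width (direct_product \<Lambda>) D =
      (INF f\<in>direct_product (\<lambda>i. dual_lattice (\<Lambda> i)) - {0}. ereal (length_of_image f D))"
    unfolding lattice_width_def dual length_of_image_def ..
  have "lattice_width (direct_product \<Lambda>) D \<le> W i" for i
    unfolding wD W
  proof (rule INF_greatest)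
    fix g assume g: "g \<in> dual_lattice (\<Lambda> i) - {0}"
    then have "axis i g \<in> direct_product (\<lambda>i. dual_lattice (\<Lambda> i)) - {0}"
      using dual0 by (auto simp: direct_product_def axis_def vec_eq_iff)
    then show "(INF f\<in>direct_product (\<lambda>i. dual_lattice (\<Lambda> i)) - {0}. ereal (length_of_image f D))
        \<le> ereal (k i * length_of_image g (C i))"
      by (rule INF_lower2) (simp add: w_axis)
  qed
  then show "lattice_width (direct_product \<Lambda>) D \<le> (MIN i. ereal (k i) * lattice_width (\<Lambda> i) (C i))"
    unfolding W_def[symmetric] by (intro Min.boundedI) auto
  show "(MIN i. ereal (k i) * lattice_width (\<Lambda> i) (C i)) \<le> lattice_width (direct_product \<Lambda>) D"
    unfolding W_def[symmetric] wD
  proof (rule INF_greatest)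
    fix f assume f: "f \<in> direct_product (\<lambda>i. dual_lattice (\<Lambda> i)) - {0}"
    then obtain i where i: "f $ i \<noteq> 0" by (auto simp: vec_eq_iff)
    have "(MIN i. W i) \<le> W i" by (intro Min_le) auto
    also have "\<dots> \<le> ereal (k i * length_of_image (f $ i) (C i))"
      unfolding W by (rule INF_lower) (use f i in \<open>auto simp: direct_product_def\<close>)
    also have "\<dots> \<le> ereal (length_of_image f D)" using w_le by simp
    finally show "(MIN i. W i) \<le> ereal (length_of_image f D)" .
  qed
qed

section \<open>Relative interiors and hollowness\<close>

lemma interior_of_top_of_set_iff:
  fixes V K :: "'a::metric_space set"
  assumes "K \<subseteq> V"
  shows "x \<in> top_of_set V interior_of K \<longleftrightarrow> x \<in> V \<and> (\<exists>e>0. ball x e \<inter> V \<subseteq> K)"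
proof
  assume "x \<in> top_of_set V interior_of K"
  then obtain T where T: "open T" "x \<in> V \<inter> T" "V \<inter> T \<subseteq> K"
    unfolding interior_of_def openin_open by blast
  then obtain e where "e > 0" "ball x e \<subseteq> T"
    unfolding open_contains_ball by blast
  then show "x \<in> V \<and> (\<exists>e>0. ball x e \<inter> V \<subseteq> K)"
    using T by blast
next
  assume "x \<in> V \<and> (\<exists>e>0. ball x e \<inter> V \<subseteq> K)"
  then obtain e where "x \<in> V" "e > 0" "ball x e \<inter> V \<subseteq> K" by blast
  then show "x \<in> top_of_set V interior_of K"
    unfolding interior_of_def openin_open
    by (intro CollectI exI[of _ "V \<inter> ball x e"]) auto
qed

text \<open>The homothety with centre \<open>c\<close> and ratio \<open>s\<close> maps a relative
  ball of radius \<open>e\<close> around \<open>a\<close> to one of radius \<open>s * e\<close>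
  around the combination, and convexity keeps the image in \<open>K\<close>.\<close>

lemma interior_of_convex_combination:
  fixes V K :: "'a::euclidean_space set"
  assumes "subspace V" "convex K" "K \<subseteq> V" "a \<in> top_of_set V interior_of K" "c \<in> K" "0 < s" "s \<le> 1"
  shows "(1 - s) *\<^sub>R c + s *\<^sub>R a \<in> top_of_set V interior_of K"
proof -
  define x where "x = (1 - s) *\<^sub>R c + s *\<^sub>R a"
  obtain e where a: "a \<in> V" and e: "e > 0" "ball a e \<inter> V \<subseteq> K"
    using assms(4) unfolding interior_of_top_of_set_iff[OF assms(3)] by blast
  have xV: "x \<in> V"
    unfolding x_def using assms(1,3,5) a by (intro subspace_add subspace_scale) auto
  have "z \<in> K" if z: "z \<in> ball x (s * e) \<inter> V" for z
  proof -
    \<comment> \<open>The preimage of \<open>z\<close> under the homothety.\<close>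
    define y where "y = a + (1 / s) *\<^sub>R (z - x)"
    have "dist a y = norm (x - z) / s"
      using assms(6) by (simp add: y_def dist_norm norm_minus_commute)
    also have "\<dots> < e"
      using z assms(6) by (simp add: dist_norm field_simps)
    finally have "y \<in> ball a e" by simp
    moreover have "y \<in> V"
      unfolding y_def using assms(1) a xV z
      by (intro subspace_add subspace_scale subspace_diff) auto
    ultimately have "y \<in> K" using e by blast
    then have "(1 - s) *\<^sub>R c + s *\<^sub>R y \<in> K"
      using assms by (intro convexD) auto
    moreover have "(1 - s) *\<^sub>R c + s *\<^sub>R y = z"
      using assms(6) by (simp add: y_def x_def scaleR_add_right)
    ultimately show ?thesis by simp
  qed
  moreover have "0 < s * e"
    using assms(6) e by simp
  ultimately show ?thesis
    unfolding interior_of_top_of_set_iff[OF assms(3)] x_def[symmetric] using xV by blast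
qed

text \<open>Moving only coordinate \<open>i\<close> of \<open>x\<close> within a small ball stays in
  the direct sum, so \<open>x $ i\<close> is interior. Moving \<open>x\<close> slightly outwards
  also stays inside; scaling back makes the total weight less than 1.\<close>

lemma interior_of_direct_sum:
  fixes V K :: "'m::finite \<Rightarrow> 'a::euclidean_space set"
  assumes V: "\<And>i. subspace (V i)" and K: "\<And>i. K i \<subseteq> V i" "\<And>i. convex (K i)" "\<And>i. 0 \<in> K i"
    and x: "x \<in> top_of_set (direct_product V) interior_of (direct_sum K)"
  shows "x $ i \<in> top_of_set (V i) interior_of (K i)"
    and "\<exists>l y. (\<forall>i. y i \<in> K i) \<and> (\<forall>i. 0 \<le> l i) \<and> (\<Sum>i\<in>UNIV. l i) < 1 \<and> x = (\<chi> i. l i *\<^sub>R y i)"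
proof -
  have scale: "l *\<^sub>R y \<in> K i" if "y \<in> K i" "0 \<le> l" "l \<le> 1" for l y i
    using convexD[OF K(2) that(1) K(3), of l "1 - l"] that by simp
  have sub: "direct_sum K \<subseteq> direct_product V"
    unfolding direct_sum_def direct_product_def
    using subspace_scale[OF V subsetD[OF K(1)]] by auto
  obtain e where xV: "x \<in> direct_product V" and e: "e > 0"
    and ball: "ball x e \<inter> direct_product V \<subseteq> direct_sum K"
    using x unfolding interior_of_top_of_set_iff[OF sub] by blast
  have "z \<in> K i" if z: "z \<in> ball (x $ i) e \<inter> V i" for z
  proof -
    have dist: "dist x (x + axis i (z - x $ i)) = dist (x $ i) z"
      by (simp add: dist_norm norm_eq_sqrt_inner inner_axis_axis inner_commute inner_diff_right inner_diff_left)
    have "x + axis i (z - x $ i) \<in> ball x e \<inter> direct_product V"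
      using z xV dist by (auto simp: direct_product_def axis_def V subspace_0)
    then obtain l y where ly: "\<And>j. y j \<in> K j" "\<And>j. 0 \<le> l j" "sum l UNIV = 1"
      "x + axis i (z - x $ i) = (\<chi> j. l j *\<^sub>R y j)"
      using ball unfolding direct_sum_def by blast
    from arg_cong[OF ly(4), of "\<lambda>v. v $ i"] have "z = l i *\<^sub>R y i"
      by (simp add: axis_def)
    then show ?thesis
      using scale[of "y i" i "l i"] ly member_le_sum[of i UNIV l] by simp
  qed
  then show "x $ i \<in> top_of_set (V i) interior_of (K i)"
    unfolding interior_of_top_of_set_iff[OF K(1)]
    using xV e by (auto simp: direct_product_def)
  \<comment> \<open>The \<open>+ 1\<close> covers \<open>x = 0\<close>, and the factor 2 makes the
    displacement \<open>\<epsilon> * norm x\<close> strictly smaller than \<open>e\<close>.\<close>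
  define \<epsilon> where "\<epsilon> = e / (norm x + 1) / 2"
  have \<epsilon>: "\<epsilon> > 0" using e by (simp add: \<epsilon>_def add_nonneg_pos)
  have "\<epsilon> * norm x < e"
  proof -
    have "\<epsilon> * norm x \<le> e / 2"
      using e by (simp add: \<epsilon>_def divide_simps add_nonneg_pos)
    then show ?thesis using e by simp
  qed
  then have "(1 + \<epsilon>) *\<^sub>R x \<in> ball x e \<inter> direct_product V"
    using xV V \<epsilon> by (auto simp: dist_norm scaleR_add_left direct_product_def intro: subspace_add subspace_scale)
  then obtain l y where ly: "\<And>j. y j \<in> K j" "\<And>j. 0 \<le> l j" "sum l UNIV = 1"
      "(1 + \<epsilon>) *\<^sub>R x = (\<chi> j. l j *\<^sub>R y j)"
    using ball unfolding direct_sum_def by blast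
  have "x = (1 / (1 + \<epsilon>)) *\<^sub>R ((1 + \<epsilon>) *\<^sub>R x)" using \<epsilon> by simp
  also have "\<dots> = (\<chi> j. (l j / (1 + \<epsilon>)) *\<^sub>R y j)"
    unfolding ly(4) by (simp add: vec_eq_iff)
  finally have "x = (\<chi> j. (l j / (1 + \<epsilon>)) *\<^sub>R y j)" .
  moreover have "(\<Sum>j\<in>UNIV. l j / (1 + \<epsilon>)) < 1"
    using \<epsilon> ly(3) by (simp add: sum_divide_distrib[symmetric])
  ultimately show "\<exists>l y. (\<forall>i. y i \<in> K i) \<and> (\<forall>i. 0 \<le> l i) \<and> (\<Sum>i\<in>UNIV. l i) < 1 \<and> x = (\<chi> i. l i *\<^sub>R y i)"
    using ly \<epsilon> by (intro exI[of _ "\<lambda>j. l j / (1 + \<epsilon>)"] exI[of _ y]) auto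
qed

lemma interior_of_unscaleR:
  fixes V K :: "'a::euclidean_space set"
  assumes "subspace V" "K \<subseteq> V" "0 < k" "x \<in> top_of_set V interior_of ((*\<^sub>R) k ` K)"
  shows "(1 / k) *\<^sub>R x \<in> top_of_set V interior_of K"
proof -
  have sub: "(*\<^sub>R) k ` K \<subseteq> V"
    using assms(1,2) by (auto intro: subspace_scale)
  obtain e where x: "x \<in> V" and e: "e > 0" "ball x e \<inter> V \<subseteq> (*\<^sub>R) k ` K"
    using assms(4) unfolding interior_of_top_of_set_iff[OF sub] by blast
  have "z \<in> K" if z: "z \<in> ball ((1 / k) *\<^sub>R x) (e / k) \<inter> V" for z
  proof -
    have "x - k *\<^sub>R z = k *\<^sub>R ((1 / k) *\<^sub>R x - z)"
      using assms(3) by (simp add: scaleR_diff_right)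
    then have "dist x (k *\<^sub>R z) = k * dist ((1 / k) *\<^sub>R x) z"
      using assms(3) unfolding dist_norm by simp
    then have "k *\<^sub>R z \<in> ball x e \<inter> V"
      using z assms(1,3) by (auto simp: field_simps intro: subspace_scale)
    then show "z \<in> K" using e(2) assms(3) by auto
  qed
  then show ?thesis
    unfolding interior_of_top_of_set_iff[OF assms(2)]
    using x e(1) assms(1,3) by (auto intro!: subspace_scale exI[of _ "e / k"])
qed

text \<open>The point \<open>x / k\<close> is interior to \<open>K\<close>. If
  \<open>k \<le> 1\<close>, then \<open>x\<close> lies between it and the origin; otherwise
  \<open>x\<close> lies between it and a point \<open>x / r\<close> of \<open>K\<close> with
  \<open>r < 1\<close>. In both cases the interior point has positive weight.\<close>

lemma interior_of_if_shrink_mem: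
  fixes V K :: "'a::euclidean_space set"
  assumes V: "subspace V" "K \<subseteq> V" and K: "convex K" "0 \<in> K" and k: "0 < k"
    and x: "x \<in> top_of_set V interior_of ((*\<^sub>R) k ` K)"
    and t: "0 \<le> t" "t < 1" "c \<in> K" "x = t *\<^sub>R c"
  shows "x \<in> top_of_set V interior_of K"
proof -
  note a = interior_of_unscaleR[OF V k x]
  \<comment> \<open>A scale strictly above \<open>t\<close>, so that dividing by it is possible even when \<open>t = 0\<close>.\<close>
  define r where "r = (1 + t) / 2"
  have r: "0 < r" "t \<le> r" "r < 1" using t by (auto simp: r_def)
  have c': "(1 / r) *\<^sub>R x \<in> K"
    using convexD[OF K(1) t(3) K(2), of "t / r" "1 - t / r"] t r by simp
  show ?thesis
  proof (cases "k \<le> 1")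
    case True
    have "(1 - k) *\<^sub>R 0 + k *\<^sub>R ((1 / k) *\<^sub>R x) \<in> top_of_set V interior_of K"
      by (rule interior_of_convex_combination[OF V(1) K(1) V(2) a K(2) k True])
    then show ?thesis using k by simp
  next
    case False
    \<comment> \<open>\<open>s\<close> solves \<open>(1 - s) / r + s / k = 1\<close>, which puts \<open>x\<close> between \<open>x / r\<close> and \<open>x / k\<close>.\<close>
    define s where "s = (1 - r) / (1 - r / k)"
    \<comment> \<open>As \<open>k > 1\<close>, the numerator \<open>1 - r\<close> of
      \<open>s\<close> is positive and smaller than its denominator.\<close>
    have rk: "r / k < r" "1 - r / k > 0"
      using False r k by (auto simp: field_simps)
    then have s: "0 < s" "s \<le> 1" using r by (auto simp: s_def)
    have "(1 - s) / r + s / k = 1"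
    proof -
      have "(1 - s) / r + s / k = (1 - s * (1 - r / k)) / r"
        using r k by (simp add: field_simps)
      also have "s * (1 - r / k) = 1 - r"
        by (rule nonzero_eq_divide_eq[THEN iffD1, OF _ s_def]) (use rk(2) in linarith)
      finally show ?thesis using r by simp
    qed
    then have "(1 - s) *\<^sub>R ((1 / r) *\<^sub>R x) + s *\<^sub>R ((1 / k) *\<^sub>R x) = x"
      by (simp add: scaleR_add_left[symmetric])
    then show ?thesis
      using interior_of_convex_combination[OF V(1) K(1) V(2) a c' s] by simp
  qed
qed

lemma hollow_scaled_direct_sum:
  fixes V C \<Lambda> :: "'m::finite \<Rightarrow> 'a::euclidean_space set"
  assumes V: "\<And>i. subspace (V i)" and C: "\<And>i. C i \<subseteq> V i" "\<And>i. convex (C i)" "\<And>i. 0 \<in> C i"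
    and k: "\<And>i. 0 < k i"
    and hollow: "\<And>i. hollow (V i) (\<Lambda> i) (C i)" and sum: "(\<Sum>i\<in>UNIV. 1 / k i) \<ge> 1"
  shows "hollow (direct_product V) (direct_product \<Lambda>) (direct_sum (\<lambda>i. (*\<^sub>R) (k i) ` C i))"
  unfolding hollow_def
proof (intro equals0I, elim IntE)
  fix x
  assume x: "x \<in> top_of_set (direct_product V) interior_of direct_sum (\<lambda>i. (*\<^sub>R) (k i) ` C i)"
    and "x \<in> direct_product \<Lambda>"
  have kC: "(*\<^sub>R) (k i) ` C i \<subseteq> V i" "convex ((*\<^sub>R) (k i) ` C i)" "0 \<in> (*\<^sub>R) (k i) ` C i" for i
    using V C by (auto intro: subspace_scale convex_scaling image_eqI[of _ _ 0])
  note int = interior_of_direct_sum[OF V kC x]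
  obtain l y where ly: "\<And>i. y i \<in> (*\<^sub>R) (k i) ` C i" "\<And>i. 0 \<le> l i" "(\<Sum>i\<in>UNIV. l i) < 1"
    "x = (\<chi> i. l i *\<^sub>R y i)"
    using int(2) by blast
  \<comment> \<open>If \<open>1 / k i \<le> l i\<close> held for every \<open>i\<close>, the weights
    would sum to at least 1. The factor \<open>l i * k i\<close> below 1 then serves as the
    shrinking factor \<open>t\<close>.\<close>
  obtain i where i: "l i < 1 / k i"
    using sum_mono[of UNIV "\<lambda>i. 1 / k i" l] sum ly(3) by (meson not_le order_trans)
  obtain c where c: "c \<in> C i" "y i = k i *\<^sub>R c" using ly(1) by blast
  have "x $ i \<in> top_of_set (V i) interior_of (C i)"
  proof (rule interior_of_if_shrink_mem[OF V C k int(1)])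
    show "0 \<le> l i * k i" "l i * k i < 1"
      using ly(2)[of i] i k[of i] by (simp_all add: field_simps)
    show "x $ i = (l i * k i) *\<^sub>R c" by (simp add: ly(4) c)
  qed (fact c)
  moreover have "x $ i \<in> \<Lambda> i"
    using \<open>x \<in> direct_product \<Lambda>\<close> by (simp add: direct_product_def)
  ultimately show False
    using hollow[of i] unfolding hollow_def by blast
qed

section \<open>Specialization to lattices and convex bodies\<close>

lemma zero_in_lattice:
  assumes "lattice_in V \<Lambda>"
  shows "0 \<in> \<Lambda>"
proof -
  obtain B where "\<Lambda> = {(\<Sum>b\<in>B. of_int (z b) *\<^sub>R b) | z. True}"
    using assms unfolding lattice_in_def by blast
  then show ?thesis
    by (auto intro!: exI[of _ "\<lambda>_. 0"])
qed

theorem theorem2p2: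
  fixes V :: "'m::finite \<Rightarrow> 'a::euclidean_space set"
    and d :: "'m \<Rightarrow> nat"
    and \<Lambda> :: "'m \<Rightarrow> 'a set"
    and C :: "'m \<Rightarrow> 'a set"
    and k :: "'m \<Rightarrow> real"
  assumes "\<And>i. subspace (V i)" and "\<And>i. dim (V i) = d i"
    and "\<And>i. lattice_in (V i) (\<Lambda> i)"
    and "\<And>i. convex_body (V i) (C i)" and "\<And>i. 0 \<in> C i"
    and "\<And>i. k i > 0"
  defines "D \<equiv> direct_sum (\<lambda>i. (*\<^sub>R) (k i) ` C i)"
  shows "((\<forall>i. lattice_polytope (\<Lambda> i) ((*\<^sub>R) (k i) ` C i)) \<longrightarrow>
            lattice_polytope (direct_product \<Lambda>) D) \<and>
         ((\<forall>i. simplex_with_origin (C i)) \<longrightarrow> simplex_with_origin D) \<and>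
         lattice_width (direct_product \<Lambda>) D =
            (MIN i. ereal (k i) * lattice_width (\<Lambda> i) (C i)) \<and>
         ((\<forall>i. hollow (V i) (\<Lambda> i) (C i)) \<and> (\<Sum>i\<in>UNIV. 1 / k i) \<ge> 1 \<longrightarrow>
            hollow (direct_product V) (direct_product \<Lambda>) D)"
proof (intro conjI impI)
  note sub = assms(1) and body = assms(4) and zero = assms(5) and k = assms(6)
  have C: "C i \<subseteq> V i" "convex (C i)" "compact (C i)" for i
    using body unfolding convex_body_def by blast+
  have \<Lambda>: "0 \<in> \<Lambda> i" for i
    using assms(3) by (rule zero_in_lattice)
  have ne: "(*\<^sub>R) (k i) ` C i \<noteq> {}" for i
    using zero by blast
  show "lattice_polytope (direct_product \<Lambda>) D"
    if "\<forall>i. lattice_polytope (\<Lambda> i) ((*\<^sub>R) (k i) ` C i)"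
    unfolding D_def by (intro lattice_polytope_direct_sum that[rule_format] ne \<Lambda>)
  show "simplex_with_origin D" if "\<forall>i. simplex_with_origin (C i)"
    unfolding D_def
    by (intro simplex_with_origin_direct_sum simplex_with_origin_scaleR that[rule_format]
        less_imp_neq[OF k, symmetric])
  show "lattice_width (direct_product \<Lambda>) D = (MIN i. ereal (k i) * lattice_width (\<Lambda> i) (C i))"
    unfolding D_def by (intro lattice_width_scaled_direct_sum C zero \<Lambda> k)
  show "hollow (direct_product V) (direct_product \<Lambda>) D"
    if "(\<forall>i. hollow (V i) (\<Lambda> i) (C i)) \<and> (\<Sum>i\<in>UNIV. 1 / k i) \<ge> 1"
    unfolding D_def using that by (intro hollow_scaled_direct_sum sub C zero k) auto
qed

end
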